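(* Let $1\le p\le q$, $n=p+q$, $G=Sp(p,q)$, and let $\mu=(a_1,\dots,a_p\mid b_1,\dots,b_q)$ be a $\Delta^+(\mathfrak k,\mathfrak t)$-dominant weight. Choose $w\in W(\mathfrak g,\mathfrak t)^1$ such that $\mu+2\rho_c\in\mathcal C_w$ and write $\mu+2\rho_c=(x_1,\dots,x_p\mid y_1,\dots,y_q)$. Let $$e(\mu):=\mathrm{card}\{(i,j)\mid 1\le i\le p,\ 1\le j\le q,\ x_i=y_j\}.$$ Then $L(\mu):=\|\mu\|_{\rm lambda}^2$ satisfies $$L(\mu)=\|\mu+2\rho_c-\rho^{(w)}\|^2-\frac{e(\mu)}2 .$$ Specifically, $$L(\mu)=\sum_{i=1}^p\bigl(x_i^2-2(n-i+1)x_i\bigr)+\sum_{j=1}^q\bigl(y_j^2-2(n-j+1)y_j\bigr)+\sum_{s=1}^n s^2+2\sum_{i=1}^p\sum_{j=1}^q\min\{x_i,y_j\}-\frac{e(\mu)}2 .$$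
   Context: Vectors in $\mathbb R^n$ are written $(a_1,\dots,a_p\mid b_1,\dots,b_q)$ and carry the Euclidean norm. A $\Delta^+(\mathfrak k,\mathfrak t)$-dominant weight (highest weight of an irreducible representation of $K=Sp(p)\times Sp(q)$) is an integral vector with $a_1\ge\dots\ge a_p\ge0$ and $b_1\ge\dots\ge b_q\ge 0$. Put $\rho_c=(p,\dots,1\mid q,\dots,1)$, $\rho=(n,n-1,\dots,1)$, $\mathcal C=\{a_1\ge\dots\ge a_p\ge0,\ b_1\ge\dots\ge b_q\ge0\}$, $\mathcal C_{\mathfrak g}=\{z_1\ge\dots\ge z_n\ge0\}\subset\mathbb R^n$. $W(\mathfrak g,\mathfrak t)$ is the group of signed permutations of coordinates, $W(\mathfrak g,\mathfrak t)^1=\{w: w\mathcal C_{\mathfrak g}\subset\mathcal C\}$ (equivalently, $w$ selects $p$ of the $n$ coordinates, places them in their original order in the first block, and the remaining $q$ coordinates in their original order in the second block), $\mathcal C_w=w\mathcal C_{\mathfrak g}$, $\rho^{(w)}=w\rho$. The lambda norm: for a dominant weight $\mu$ choose $w\in W(\mathfrak g,\mathfrak t)^1$ with $\mu+2\rho_c\in\mathcal C_w$, and let $\lambda_a(\mu)$ be the unique point of $\mathcal C_w$ closest to $\mu+2\rho_c-\rho^{(w)}$ (independent of the choice of $w$); $\|\mu\|_{\rm lambda}=\|\lambda_a(\mu)\|$. *)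

theory Defs
  imports "HOL-Analysis.L2_Norm" "HOL-Combinatorics.Permutations" "HOL-Library.Function_Algebras"
begin

text \<open>A vector of \<open>\<real>\<^sup>n\<close> is a function \<open>nat \<Rightarrow> real\<close> vanishing off \<open>{1..n}\<close>, so that the pointwise
  operations on functions are the vector operations and equality of functions is equality of
  vectors. The Euclidean norm of such a \<open>v\<close> is \<open>L2_set v {1..n}\<close>. For \<open>n = p + q\<close> the first block
  occupies the coordinates \<open>1..p\<close> and the second one the coordinates \<open>p+1..p+q\<close>.\<close>

definition Rn :: "nat \<Rightarrow> (nat \<Rightarrow> real) set" where
  "Rn n = {v. \<forall>k. k \<notin> {1..n} \<longrightarrow> v k = 0}"

definition blocks :: "nat \<Rightarrow> nat \<Rightarrow> (nat \<Rightarrow> real) \<Rightarrow> (nat \<Rightarrow> real) \<Rightarrow> nat \<Rightarrow> real" where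
  "blocks p q a b = (\<lambda>k. if k \<in> {1..p} then a k
                          else if k \<in> {p+1..p+q} then b (k - p) else 0)"

definition decreasing_nonneg :: "nat \<Rightarrow> (nat \<Rightarrow> real) \<Rightarrow> bool" where
  "decreasing_nonneg m f \<longleftrightarrow> antimono_on {1..m} f \<and> (\<forall>i\<in>{1..m}. 0 \<le> f i)"

definition rho_c :: "nat \<Rightarrow> nat \<Rightarrow> nat \<Rightarrow> real" where
  "rho_c p q = blocks p q (\<lambda>i. real p - real i + 1) (\<lambda>j. real q - real j + 1)"

definition rho :: "nat \<Rightarrow> nat \<Rightarrow> real" where
  "rho n = (\<lambda>k. if k \<in> {1..n} then real n - real k + 1 else 0)"

definition cone_k :: "nat \<Rightarrow> nat \<Rightarrow> (nat \<Rightarrow> real) set" where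
  "cone_k p q = {v \<in> Rn (p + q). decreasing_nonneg p v \<and> decreasing_nonneg q (\<lambda>j. v (p + j))}"

definition cone_g :: "nat \<Rightarrow> (nat \<Rightarrow> real) set" where
  "cone_g n = {z \<in> Rn n. decreasing_nonneg n z}"

definition dominant_weight :: "nat \<Rightarrow> nat \<Rightarrow> (nat \<Rightarrow> real) \<Rightarrow> bool" where
  "dominant_weight p q \<mu> \<longleftrightarrow> \<mu> \<in> cone_k p q \<and> (\<forall>k\<in>{1..p+q}. \<mu> k \<in> \<int>)"

text \<open>Elements of the Weyl group are the signed permutations, as maps on vectors.\<close>

definition signed_perms :: "nat \<Rightarrow> ((nat \<Rightarrow> real) \<Rightarrow> nat \<Rightarrow> real) set" where
  "signed_perms n = {w. \<exists>\<sigma> \<epsilon>. \<sigma> permutes {1..n} \<and>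
      (\<forall>k. \<epsilon> k \<in> {1, -1}) \<and> (\<forall>k. k \<notin> {1..n} \<longrightarrow> \<epsilon> k = 1) \<and>
      w = (\<lambda>z k. \<epsilon> k * z (\<sigma> k))}"

definition W1 :: "nat \<Rightarrow> nat \<Rightarrow> ((nat \<Rightarrow> real) \<Rightarrow> nat \<Rightarrow> real) set" where
  "W1 p q = {w \<in> signed_perms (p + q). w ` cone_g (p + q) \<subseteq> cone_k p q}"

definition shifted :: "nat \<Rightarrow> nat \<Rightarrow> (nat \<Rightarrow> real) \<Rightarrow> nat \<Rightarrow> real" where
  "shifted p q \<mu> = \<mu> + (\<lambda>k. 2 * rho_c p q k)"

definition nearest_point :: "nat \<Rightarrow> (nat \<Rightarrow> real) set \<Rightarrow> (nat \<Rightarrow> real) \<Rightarrow> nat \<Rightarrow> real" where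
  "nearest_point n S v =
     (THE l. l \<in> S \<and> (\<forall>u\<in>S. L2_set (v - l) {1..n} \<le> L2_set (v - u) {1..n}))"

definition lambda_a :: "nat \<Rightarrow> nat \<Rightarrow> (nat \<Rightarrow> real) \<Rightarrow> nat \<Rightarrow> real" where
  "lambda_a p q \<mu> =
     (let w = (SOME w. w \<in> W1 p q \<and> shifted p q \<mu> \<in> w ` cone_g (p + q))
      in nearest_point (p + q) (w ` cone_g (p + q)) (shifted p q \<mu> - w (rho (p + q))))"

definition lambda_norm :: "nat \<Rightarrow> nat \<Rightarrow> (nat \<Rightarrow> real) \<Rightarrow> real" where
  "lambda_norm p q \<mu> = L2_set (lambda_a p q \<mu>) {1..p+q}"

definition tie_count :: "nat \<Rightarrow> nat \<Rightarrow> (nat \<Rightarrow> real) \<Rightarrow> nat" where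
  "tie_count p q \<mu> =
     card {(i, j). 1 \<le> i \<and> i \<le> p \<and> 1 \<le> j \<and> j \<le> q \<and> shifted p q \<mu> i = shifted p q \<mu> (p + j)}"

end

theory Submission
  imports Defs
begin

text \<open>Write \<open>v = \<mu> + 2\<rho>\<^sub>c\<close>. Inside each block the entries of \<open>v\<close> are integers that drop by at least
  \<open>2\<close> and stay at least \<open>2\<close>. Hence a Weyl group element \<open>w\<close> that takes a vector \<open>z\<close> of the dominant
  chamber to \<open>v\<close> changes no signs, it is just composition with a permutation, and \<open>z\<close> is the
  decreasing rearrangement of \<open>v\<close>. Composition with a permutation is an isometry, so everything can
  be computed with \<open>z\<close> and \<open>\<rho>\<close> instead of \<open>v\<close> and \<open>w\<rho>\<close>.

  Among three entries of \<open>z\<close> two come from the same block, so \<open>z k - z (k + 2) \<ge> 2\<close>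
  (\<open>spread_sorted\<close>). The successive differences of \<open>u = z - \<rho>\<close> are \<open>z k - z (k + 1) - 1\<close>. Since \<open>z\<close>
  is integral, they are nonnegative except at the ties \<open>z k = z (k + 1)\<close>, where the difference is
  \<open>-1\<close>, and no two ties overlap. The point of the dominant chamber nearest to \<open>u\<close> arises by replacing
  the two entries at each tie by their mean (\<open>averaged\<close>). By Moreau's criterion for the projection to
  a convex cone it suffices that the averaged vector lies in the cone and that the residual is
  orthogonal to it and makes no acute angle with any vector of the cone
  (\<open>averaged_in_cone\<close>, \<open>residual_orthogonal\<close>, \<open>residual_polar\<close>). Each tie contributes two
  residual entries \<open>\<plusminus>1/2\<close>, so by the theorem of Pythagoras it lowers the squared norm by \<open>1/2\<close>
  (\<open>norm_averaged\<close>).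

  It remains to express the number of ties and \<open>\<parallel>z - \<rho>\<parallel>\<^sup>2\<close> by the two blocks. Up to terms in which
  the order of the entries is irrelevant, the former and the inner product of \<open>z\<close> with \<open>\<rho>\<close> are
  multiples of double sums \<open>\<Sum>\<^sub>k\<Sum>\<^sub>l f (z k) (z l)\<close> with \<open>f\<close> symmetric, the indicator of
  equality and the minimum respectively. Such sums do not see the order of the entries, so they may be
  computed with \<open>v\<close> in place of \<open>z\<close>, where they split into the parts of the two blocks and twice a
  mixed part (\<open>tie_count_eq\<close>, \<open>shifted_norm_formula\<close>). The resulting formula does not mention
  \<open>w\<close>, which makes the result independent of the choice hidden in the definition of \<open>\<lambda>\<^sub>a\<close>.\<close>

section \<open>Symmetric double sums\<close>

lemma sum_symmetric_square:
  fixes f :: "nat \<Rightarrow> nat \<Rightarrow> real"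
  assumes "\<And>k l. f k l = f l k"
  shows "(\<Sum>k=1..n. \<Sum>l=1..n. f k l) = (\<Sum>k=1..n. f k k + 2 * (\<Sum>l=1..<k. f k l))"
proof (induction n)
  case 0
  show ?case by simp
next
  case (Suc n)
  have "(\<Sum>k=1..n. f k (Suc n)) = (\<Sum>l=1..n. f (Suc n) l)"
    using assms by (intro sum.cong) auto
  moreover have "{1..<Suc n} = {1..n}" by auto
  ultimately show ?case
    using Suc.IH by (simp add: sum.distrib)
qed

text \<open>This turns the weighted sum \<open>\<Sum> k \<cdot> z k\<close>, in which the position of an entry matters, into an
  expression that is invariant under permutations: \<open>z k\<close> is the minimum of itself and each of the
  \<open>k - 1\<close> entries before it.\<close>

lemma sum_min_square:
  fixes v :: "nat \<Rightarrow> real"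
  assumes "antimono_on {1..n} v"
  shows "(\<Sum>k=1..n. \<Sum>l=1..n. min (v k) (v l)) = (\<Sum>k=1..n. (2 * real k - 1) * v k)"
proof -
  have "v k + 2 * (\<Sum>l=1..<k. min (v k) (v l)) = (2 * real k - 1) * v k" if "k \<in> {1..n}" for k
  proof -
    have "(\<Sum>l=1..<k. min (v k) (v l)) = (\<Sum>l=1..<k. v k)"
    proof (rule sum.cong)
      fix l assume "l \<in> {1..<k}"
      then have "v k \<le> v l"
        using that assms by (intro monotone_onD[OF assms]) auto
      then show "min (v k) (v l) = v k" by simp
    qed simp
    also have "\<dots> = (real k - 1) * v k"
      using that by (simp add: of_nat_diff)
    finally show ?thesis by (simp add: algebra_simps)
  qed
  then show ?thesis
    by (subst sum_symmetric_square) (auto simp: min.commute intro!: sum.cong)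
qed

lemma sum_blocks:
  fixes g :: "nat \<Rightarrow> 'a::comm_monoid_add"
  shows "(\<Sum>k=1..p+q. g k) = (\<Sum>i=1..p. g i) + (\<Sum>j=1..q. g (p + j))"
  by (induction q) (auto simp: add.assoc)

lemma sum_blocks_square:
  fixes f :: "nat \<Rightarrow> nat \<Rightarrow> real"
  assumes "\<And>k l. f k l = f l k"
  shows "(\<Sum>k=1..p+q. \<Sum>l=1..p+q. f k l)
    = (\<Sum>i=1..p. \<Sum>k=1..p. f i k) + (\<Sum>j=1..q. \<Sum>k=1..q. f (p + j) (p + k))
      + 2 * (\<Sum>i=1..p. \<Sum>j=1..q. f i (p + j))"
proof -
  have "(\<Sum>j=1..q. \<Sum>i=1..p. f (p + j) i) = (\<Sum>i=1..p. \<Sum>j=1..q. f i (p + j))"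
    using assms by (subst sum.swap) (auto intro!: sum.cong)
  then show ?thesis
    by (simp only: sum_blocks sum.distrib)
qed

lemma sum_permuted_square:
  fixes f :: "real \<Rightarrow> real \<Rightarrow> real"
  assumes "\<sigma> permutes A"
  shows "(\<Sum>k\<in>A. \<Sum>l\<in>A. f (z (\<sigma> k)) (z (\<sigma> l))) = (\<Sum>k\<in>A. \<Sum>l\<in>A. f (z k) (z l))"
proof -
  have "(\<Sum>k\<in>A. \<Sum>l\<in>A. f (z (\<sigma> k)) (z (\<sigma> l))) = (\<Sum>k\<in>A. \<Sum>l\<in>A. f (z (\<sigma> k)) (z l))"
  proof (rule sum.cong)
    fix k
    show "(\<Sum>l\<in>A. f (z (\<sigma> k)) (z (\<sigma> l))) = (\<Sum>l\<in>A. f (z (\<sigma> k)) (z l))"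
      using sum.permute[OF assms, of "\<lambda>l. f (z (\<sigma> k)) (z l)"] by (simp add: o_def)
  qed simp
  also have "\<dots> = (\<Sum>k\<in>A. \<Sum>l\<in>A. f (z k) (z l))"
    using sum.permute[OF assms, of "\<lambda>k. \<Sum>l\<in>A. f (z k) (z l)"] by (simp add: o_def)
  finally show ?thesis .
qed

lemma sum_by_parts:
  fixes t y :: "nat \<Rightarrow> real"
  shows "(\<Sum>k=1..n. (t k - t (k - 1)) * y k)
    = (\<Sum>k=1..n. t k * (y k - y (k + 1))) + t n * y (n + 1) - t 0 * y 1"
  by (induction n) (auto simp: algebra_simps)

section \<open>Nearest points\<close>

text \<open>The variational characterization of the projection: an obtuse angle at \<open>l\<close> gives
  \<open>\<parallel>v - l\<parallel>\<^sup>2 + \<parallel>u - l\<parallel>\<^sup>2 \<le> \<parallel>v - u\<parallel>\<^sup>2\<close>, hence both minimality and uniqueness of \<open>l\<close>.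
  Uniqueness as a function uses that vectors of \<open>Rn n\<close> agree outside \<open>{1..n}\<close>.\<close>

lemma nearest_point_eqI:
  assumes S: "S \<subseteq> Rn n" and l: "l \<in> S"
    and obtuse: "\<And>u. u \<in> S \<Longrightarrow> (\<Sum>k=1..n. (v k - l k) * (u k - l k)) \<le> 0"
  shows "nearest_point n S v = l"
proof -
  have pyth: "(\<Sum>k=1..n. (v k - l k)\<^sup>2) + (\<Sum>k=1..n. (u k - l k)\<^sup>2) \<le> (\<Sum>k=1..n. (v k - u k)\<^sup>2)"
    if "u \<in> S" for u
  proof -
    have "(\<Sum>k=1..n. (v k - u k)\<^sup>2) = (\<Sum>k=1..n. (v k - l k)\<^sup>2) + (\<Sum>k=1..n. (u k - l k)\<^sup>2)
        - 2 * (\<Sum>k=1..n. (v k - l k) * (u k - l k))"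
      unfolding sum_distrib_left sum.distrib[symmetric] sum_subtractf[symmetric]
      by (intro sum.cong) (auto simp: power2_eq_square algebra_simps)
    then show ?thesis using obtuse[OF that] by simp
  qed
  show ?thesis
    unfolding nearest_point_def
  proof (rule the_equality)
    show "l \<in> S \<and> (\<forall>u\<in>S. L2_set (v - l) {1..n} \<le> L2_set (v - u) {1..n})"
    proof (intro conjI ballI)
      fix u assume "u \<in> S"
      then have "(\<Sum>k=1..n. (v k - l k)\<^sup>2) \<le> (\<Sum>k=1..n. (v k - u k)\<^sup>2)"
        using pyth[of u] sum_nonneg[of "{1..n}" "\<lambda>k. (u k - l k)\<^sup>2"] by simp
      then show "L2_set (v - l) {1..n} \<le> L2_set (v - u) {1..n}"
        by (simp add: L2_set_def)
    qed (rule l)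
  next
    fix l' assume l': "l' \<in> S \<and> (\<forall>u\<in>S. L2_set (v - l') {1..n} \<le> L2_set (v - u) {1..n})"
    then have "L2_set (v - l') {1..n} \<le> L2_set (v - l) {1..n}" using l by blast
    then have "(\<Sum>k=1..n. (v k - l' k)\<^sup>2) \<le> (\<Sum>k=1..n. (v k - l k)\<^sup>2)"
      by (simp add: L2_set_def)
    then have "(\<Sum>k=1..n. (l' k - l k)\<^sup>2) \<le> 0"
      using pyth[of l'] l' by simp
    then have "(\<Sum>k=1..n. (l' k - l k)\<^sup>2) = 0"
      using sum_nonneg[of "{1..n}" "\<lambda>k. (l' k - l k)\<^sup>2"] by simp
    then have "l' k = l k" if "k \<in> {1..n}" for k
      using that by (subst (asm) sum_nonneg_eq_0_iff) auto
    moreover have "l' k = l k" if "k \<notin> {1..n}" for k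
    proof -
      have "l \<in> Rn n" "l' \<in> Rn n" using l l' S by auto
      then show ?thesis using that by (simp add: Rn_def del: atLeastAtMost_iff)
    qed
    ultimately show "l' = l" by blast
  qed
qed

section \<open>Projecting a shifted decreasing vector\<close>

text \<open>These are the features of the decreasing rearrangement \<open>z\<close> of \<open>\<mu> + 2\<rho>\<^sub>c\<close> from which the
  projection of \<open>z - \<rho>\<close> to the dominant chamber is computed.\<close>

locale sparse_decreasing =
  fixes n :: nat and z :: "nat \<Rightarrow> real"
  assumes decreasing: "z \<in> cone_g n"
    and integral: "k \<in> {1..n} \<Longrightarrow> z k \<in> \<int>"
    and ge_2: "k \<in> {1..n} \<Longrightarrow> 2 \<le> z k"
    and gap: "1 \<le> k \<Longrightarrow> k + 2 \<le> n \<Longrightarrow> z (k + 2) + 2 \<le> z k"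
begin

definition tie :: "nat \<Rightarrow> real" where
  "tie k = of_bool (1 \<le> k \<and> k < n \<and> z k = z (k + 1))"

text \<open>If \<open>k\<close> and \<open>k + 1\<close> are tied, the corresponding entries of \<open>z - \<rho>\<close> are \<open>c\<close> and \<open>c + 1\<close>. The
  correction adds \<open>1/2\<close> to the first and subtracts \<open>1/2\<close> from the second.\<close>

definition averaged :: "nat \<Rightarrow> real" where
  "averaged k = z k - rho n k + (tie k - tie (k - 1)) / 2"

lemma tie_ends [simp]: "tie 0 = 0" "tie n = 0"
  by (auto simp: tie_def)

lemma tie_bounds: "0 \<le> tie k" "tie k \<le> 1"
  by (auto simp: tie_def)

lemma antimono: "1 \<le> k \<Longrightarrow> k \<le> l \<Longrightarrow> l \<le> n \<Longrightarrow> z l \<le> z k"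
  using decreasing by (auto simp: cone_g_def decreasing_nonneg_def intro: monotone_onD)

text \<open>A difference of at most \<open>1\<close> between neighbours leaves no room for a tie on either side, because
  entries two positions apart differ by at least \<open>2\<close>. At larger differences the corrections at the
  neighbouring ties, \<open>1/2\<close> each, cannot destroy monotonicity.\<close>

lemma tie_trichotomy:
  assumes "1 \<le> k" "k < n"
  shows "(tie k = 1 \<and> z k = z (k + 1) \<and> tie (k - 1) = 0 \<and> tie (k + 1) = 0)
    \<or> (tie k = 0 \<and> z k = z (k + 1) + 1 \<and> tie (k - 1) = 0 \<and> tie (k + 1) = 0)
    \<or> (tie k = 0 \<and> z (k + 1) + 2 \<le> z k)"
proof -
  obtain a b :: int where ab: "z k = of_int a" "z (k + 1) = of_int b"
    using assms integral[of k] integral[of "k + 1"] by (auto elim!: Ints_cases)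
  have le: "b \<le> a" using antimono[of k "k + 1"] assms ab by simp
  have "tie (k + 1) = 0" if "a \<le> b + 1"
    using that gap[of k] assms ab by (auto simp: tie_def)
  moreover have "tie (k - 1) = 0" if "a \<le> b + 1"
    using that gap[of "k - 1"] assms ab by (cases k) (auto simp: tie_def)
  moreover have "tie k = (if a = b then 1 else 0)"
    using assms ab by (simp add: tie_def)
  ultimately show ?thesis using le ab
    by (cases "a = b"; cases "a = b + 1") auto
qed

lemma rho_step: "1 \<le> k \<Longrightarrow> k < n \<Longrightarrow> rho n k = rho n (k + 1) + 1"
  by (simp add: rho_def)

lemma averaged_step:
  assumes "1 \<le> k" "k < n"
  shows "averaged (k + 1) \<le> averaged k" and "tie k = 1 \<Longrightarrow> averaged (k + 1) = averaged k"
  using tie_trichotomy[OF assms] rho_step[OF assms] tie_bounds[of "k - 1"] tie_bounds[of "k + 1"]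
  by (auto simp: averaged_def field_simps)

lemma averaged_in_cone: "averaged \<in> cone_g n"
proof -
  have anti: "averaged l \<le> averaged k" if "1 \<le> k" "k \<le> l" "l \<le> n" for k l
    using that(2,3)
  proof (induction l rule: dec_induct)
    case base
    show ?case by simp
  next
    case (step l)
    then show ?case using averaged_step(1)[of l] that(1) by simp
  qed
  have "0 \<le> averaged n" if "1 \<le> n"
    using that ge_2[of n] tie_bounds[of "n - 1"] by (simp add: averaged_def rho_def)
  then have "0 \<le> averaged k" if "k \<in> {1..n}" for k
    using that anti[of k n] by auto
  moreover have "averaged k = 0" if "k \<notin> {1..n}" for k
  proof -
    have "z k = 0" using that decreasing by (simp add: cone_g_def Rn_def)
    moreover have "tie k = 0" "tie (k - 1) = 0" "rho n k = 0"
      using that by (auto simp: tie_def rho_def)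
    ultimately show ?thesis by (simp add: averaged_def)
  qed
  ultimately show ?thesis
    using anti by (auto simp: cone_g_def Rn_def decreasing_nonneg_def monotone_on_def)
qed

text \<open>The residual at \<open>k\<close> is \<open>-(tie k - tie (k - 1)) / 2\<close>, so summation by parts applies; the boundary
  terms vanish because there are no ties at \<open>0\<close> and \<open>n\<close>.\<close>

lemma residual_inner:
  "(\<Sum>k=1..n. (z k - rho n k - averaged k) * y k) = - (\<Sum>k=1..n. tie k * (y k - y (k + 1))) / 2"
proof -
  have "(\<Sum>k=1..n. (z k - rho n k - averaged k) * y k)
      = - (\<Sum>k=1..n. (tie k - tie (k - 1)) * y k) / 2"
    unfolding sum_negf[symmetric] sum_divide_distrib
    by (intro sum.cong) (auto simp: averaged_def field_simps)
  then show ?thesis unfolding sum_by_parts by simp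
qed

lemma residual_orthogonal: "(\<Sum>k=1..n. (z k - rho n k - averaged k) * averaged k) = 0"
proof -
  have "tie k * (averaged k - averaged (k + 1)) = 0" for k
    using averaged_step(2)[of k] by (auto simp: tie_def)
  then show ?thesis unfolding residual_inner by (simp only: sum.neutral_const)
qed

lemma residual_polar:
  assumes "y \<in> cone_g n"
  shows "(\<Sum>k=1..n. (z k - rho n k - averaged k) * y k) \<le> 0"
proof -
  have "0 \<le> tie k * (y k - y (k + 1))" for k
    using assms by (auto simp: tie_def cone_g_def decreasing_nonneg_def intro: monotone_onD)
  then have "0 \<le> (\<Sum>k=1..n. tie k * (y k - y (k + 1)))" by (intro sum_nonneg)
  then show ?thesis unfolding residual_inner by simp
qed

lemma residual_obtuse:
  assumes "y \<in> cone_g n"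
  shows "(\<Sum>k=1..n. (z k - rho n k - averaged k) * (y k - averaged k)) \<le> 0"
  using residual_polar[OF assms] residual_orthogonal
  by (simp only: right_diff_distrib sum_subtractf)

text \<open>By orthogonality the squared norm of \<open>z - \<rho>\<close> exceeds that of its projection by the inner product
  of the residual with \<open>z - \<rho>\<close>. At a tie the successive difference of \<open>z - \<rho>\<close> is \<open>-1\<close>, so this inner
  product is half the number of ties.\<close>

lemma norm_averaged:
  "(\<Sum>k=1..n. (averaged k)\<^sup>2) = (\<Sum>k=1..n. (z k - rho n k)\<^sup>2) - (\<Sum>k=1..n. tie k) / 2"
proof -
  have "(\<Sum>k=1..n. (averaged k)\<^sup>2) = (\<Sum>k=1..n. (z k - rho n k)\<^sup>2)
      - (\<Sum>k=1..n. (z k - rho n k - averaged k) * (z k - rho n k))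
      - (\<Sum>k=1..n. (z k - rho n k - averaged k) * averaged k)"
    unfolding sum_subtractf[symmetric]
    by (intro sum.cong) (auto simp: power2_eq_square algebra_simps)
  also have "(\<Sum>k=1..n. (z k - rho n k - averaged k) * (z k - rho n k))
      = - (\<Sum>k=1..n. tie k * (z k - rho n k - (z (k + 1) - rho n (k + 1)))) / 2"
    by (rule residual_inner)
  also have "(\<Sum>k=1..n. tie k * (z k - rho n k - (z (k + 1) - rho n (k + 1)))) = (\<Sum>k=1..n. - tie k)"
    by (intro sum.cong) (auto simp: tie_def rho_step)
  finally show ?thesis unfolding residual_orthogonal sum_negf by simp
qed

text \<open>Equal entries at distinct positions are neighbours, hence every tie accounts for two ordered
  pairs off the diagonal.\<close>

lemma equal_pairs:
  "(\<Sum>k=1..n. \<Sum>l=1..n. of_bool (z k = z l)) = real n + 2 * (\<Sum>k=1..n. tie k)"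
proof -
  have inner: "(\<Sum>l=1..<k. of_bool (z k = z l)) = tie (k - 1)" if k: "k \<in> {1..n}" for k
  proof (cases "k = 1")
    case False
    then have "{1..<k} = insert (k - 1) {1..<k - 1}" using k by auto
    moreover have "(\<Sum>l=1..<k - 1. of_bool (z k = z l)) = (0::real)"
    proof (intro sum.neutral ballI)
      fix l assume l: "l \<in> {1..<k - 1}"
      then have "z k \<le> z (l + 2)" using k by (intro antimono) auto
      moreover have "z (l + 2) + 2 \<le> z l" using k l by (intro gap) auto
      ultimately show "of_bool (z k = z l) = (0::real)" by simp
    qed
    ultimately show ?thesis using k False by (auto simp: tie_def)
  qed simp
  have "(\<Sum>k=1..n. \<Sum>l=1..n. of_bool (z k = z l))
      = (\<Sum>k=1..n. of_bool (z k = z k) + 2 * (\<Sum>l=1..<k. of_bool (z k = z l)) :: real)"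
    by (rule sum_symmetric_square) (simp add: eq_commute)
  also have "\<dots> = (\<Sum>k=1..n. 1 + 2 * tie (k - 1))"
    using inner by (intro sum.cong) auto
  also have "\<dots> = real n + 2 * (\<Sum>k=1..n. tie (k - 1))"
    by (simp add: sum.distrib sum_distrib_left)
  also have "(\<Sum>k=1..n. tie (k - 1)) = (\<Sum>k=1..n. tie k)"
    using sum_by_parts[of tie "\<lambda>_. 1" n] by (simp add: sum_subtractf)
  finally show ?thesis .
qed

end

section \<open>Sorting a vector decreasing in two blocks\<close>

text \<open>The last condition compares two positions \<open>k < l\<close> in the same block: either both are at most
  \<open>p\<close>, or both exceed \<open>p\<close>.\<close>

definition spread :: "nat \<Rightarrow> nat \<Rightarrow> (nat \<Rightarrow> real) \<Rightarrow> bool" where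
  "spread p q v \<longleftrightarrow> v \<in> Rn (p + q) \<and> (\<forall>k\<in>{1..p+q}. v k \<in> \<int> \<and> 2 \<le> v k) \<and>
     (\<forall>k l. 1 \<le> k \<and> k < l \<and> l \<le> p + q \<and> (l \<le> p \<or> p < k) \<longrightarrow> v l + 2 \<le> v k)"

text \<open>The entries of \<open>2\<rho>\<^sub>c\<close> in a block are consecutive even numbers ending with \<open>2\<close>, and those of the
  weight are nonnegative and decreasing.\<close>

lemma spread_shifted:
  assumes "dominant_weight p q \<mu>"
  shows "spread p q (shifted p q \<mu>)"
proof -
  note defs = shifted_def rho_c_def blocks_def
  have anti1: "antimono_on {1..p} \<mu>" and anti2: "antimono_on {1..q} (\<lambda>j. \<mu> (p + j))"
    and nn1: "\<And>i. i \<in> {1..p} \<Longrightarrow> 0 \<le> \<mu> i" and nn2: "\<And>j. j \<in> {1..q} \<Longrightarrow> 0 \<le> \<mu> (p + j)"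
    and ints: "\<And>k. k \<in> {1..p+q} \<Longrightarrow> \<mu> k \<in> \<int>"
    and off: "\<And>k. k \<notin> {1..p+q} \<Longrightarrow> \<mu> k = 0"
    using assms by (auto simp: dominant_weight_def cone_k_def decreasing_nonneg_def Rn_def)
  have nn: "0 \<le> \<mu> k" if "k \<in> {1..p+q}" for k
  proof (cases "k \<le> p")
    case True
    then show ?thesis using that by (intro nn1) auto
  next
    case False
    then have "k - p \<in> {1..q}" using that by auto
    from nn2[OF this] show ?thesis using False by simp
  qed
  have mono: "\<mu> l \<le> \<mu> k" if "1 \<le> k" "k < l" "l \<le> p + q" "l \<le> p \<or> p < k" for k l
    using that(4)
  proof
    assume "l \<le> p"
    then show ?thesis using that by (intro monotone_onD[OF anti1]) auto
  next
    assume "p < k"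
    then show ?thesis using that monotone_onD[OF anti2, of "k - p" "l - p"] by auto
  qed
  have "shifted p q \<mu> l + 2 \<le> shifted p q \<mu> k"
    if "1 \<le> k" "k < l" "l \<le> p + q" "l \<le> p \<or> p < k" for k l
  proof -
    have "real k + 1 \<le> real l" using that(2) by linarith
    then show ?thesis
      using mono[OF that] that by (cases "l \<le> p") (simp_all add: defs of_nat_diff)
  qed
  moreover have "2 \<le> shifted p q \<mu> k" "shifted p q \<mu> k \<in> \<int>" if "k \<in> {1..p+q}" for k
    using that nn[OF that] ints[OF that] by (auto simp: defs of_nat_diff)
  moreover have "shifted p q \<mu> \<in> Rn (p + q)"
    using off by (auto simp: Rn_def defs)
  ultimately show ?thesis
    unfolding spread_def by blast
qed

lemma sorting_permutation:
  fixes v :: "nat \<Rightarrow> real"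
  obtains \<tau> where "\<tau> permutes {1..n}" "antimono_on {1..n} (v \<circ> \<tau>)"
proof -
  define L where "L = sort_key (\<lambda>k. - v k) [1..<n+1]"
  have len: "length L = n" and dist: "distinct L" and set: "set L = {1..n}"
    by (auto simp: L_def)
  have sorted: "sorted (map (\<lambda>k. - v k) L)" by (simp add: L_def)
  define \<tau> where "\<tau> k = (if k \<in> {1..n} then L ! (k - 1) else k)" for k
  have "bij_betw (\<lambda>k. L ! (k - 1)) {1..n} {1..n}"
  proof -
    have "bij_betw (\<lambda>k. k - 1) {1..n} {..<n}"
      by (rule bij_betw_byWitness[where f' = Suc]) auto
    moreover have "bij_betw ((!) L) {..<n} {1..n}"
      using bij_betw_nth[OF dist _ set[symmetric]] len by auto
    ultimately show ?thesis
      using bij_betw_trans by (fastforce simp: o_def)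
  qed
  then have "bij_betw \<tau> {1..n} {1..n}"
    by (rule bij_betw_cong[THEN iffD1, rotated]) (auto simp: \<tau>_def)
  then have "\<tau> permutes {1..n}"
    by (rule bij_imp_permutes) (auto simp: \<tau>_def)
  moreover have "antimono_on {1..n} (v \<circ> \<tau>)"
  proof (rule monotone_onI)
    fix k l assume "k \<in> {1..n}" "l \<in> {1..n}" "k \<le> l"
    then show "(v \<circ> \<tau>) k \<ge> (v \<circ> \<tau>) l"
      using sorted_nth_mono[OF sorted, of "k - 1" "l - 1"] len by (simp add: \<tau>_def)
  qed
  ultimately show thesis by (rule that)
qed

text \<open>Take for \<open>w\<close> the inverse of a sorting permutation, which takes the sorted vector back
  to \<open>v\<close>. Because \<open>v\<close> is strictly decreasing in each block, sorting keeps the order inside the blocks, so \<open>w\<close> maps the whole dominant chamber into the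
  chamber of the two blocks.\<close>

lemma spread_chamber:
  assumes "spread p q v"
  shows "\<exists>w\<in>W1 p q. v \<in> w ` cone_g (p + q)"
proof -
  let ?n = "p + q"
  have off: "\<And>k. k \<notin> {1..?n} \<Longrightarrow> v k = 0" and ge: "\<And>k. k \<in> {1..?n} \<Longrightarrow> 2 \<le> v k"
    and sep: "\<And>k l. \<lbrakk>1 \<le> k; k < l; l \<le> ?n; l \<le> p \<or> p < k\<rbrakk> \<Longrightarrow> v l + 2 \<le> v k"
    using assms by (auto simp: spread_def Rn_def)
  obtain \<tau> where \<tau>: "\<tau> permutes {1..?n}" and anti: "antimono_on {1..?n} (v \<circ> \<tau>)"
    by (rule sorting_permutation)
  define \<sigma> where "\<sigma> = inv \<tau>"
  have \<sigma>: "\<sigma> permutes {1..?n}" unfolding \<sigma>_def by (rule permutes_inv[OF \<tau>])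
  have \<tau>\<sigma>: "\<tau> (\<sigma> k) = k" for k unfolding \<sigma>_def by (rule permutes_inverses(1)[OF \<tau>])
  have in_iff: "\<sigma> k \<in> {1..?n} \<longleftrightarrow> k \<in> {1..?n}" for k by (rule permutes_in_image[OF \<sigma>])
  have in_iff': "\<tau> k \<in> {1..?n} \<longleftrightarrow> k \<in> {1..?n}" for k by (rule permutes_in_image[OF \<tau>])
  have z: "v \<circ> \<tau> \<in> cone_g ?n"
    unfolding cone_g_def decreasing_nonneg_def Rn_def
  proof (intro CollectI conjI ballI allI impI anti)
    show "(v \<circ> \<tau>) k = 0" if "k \<notin> {1..?n}" for k
      using off[of "\<tau> k"] in_iff'[of k] that by (simp del: atLeastAtMost_iff)
    show "0 \<le> (v \<circ> \<tau>) k" if "k \<in> {1..?n}" for k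
      using ge[of "\<tau> k"] in_iff'[of k] that by (simp del: atLeastAtMost_iff)
  qed
  have mono: "\<sigma> k \<le> \<sigma> l" if "1 \<le> k" "k \<le> l" "l \<le> ?n" "l \<le> p \<or> p < k" for k l
  proof (rule ccontr)
    assume "\<not> \<sigma> k \<le> \<sigma> l"
    then have "\<sigma> l \<le> \<sigma> k" "k < l" using that(2) by (auto simp: le_less)
    then have "(v \<circ> \<tau>) (\<sigma> k) \<le> (v \<circ> \<tau>) (\<sigma> l)"
      using that in_iff[of k] in_iff[of l] by (intro monotone_onD[OF anti]) auto
    then show False using sep[of k l] that \<open>k < l\<close> by (simp add: \<tau>\<sigma>)
  qed
  define w :: "(nat \<Rightarrow> real) \<Rightarrow> nat \<Rightarrow> real" where "w = (\<lambda>z k. z (\<sigma> k))"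
  have "w \<in> signed_perms ?n"
    unfolding signed_perms_def w_def
    by (rule CollectI, rule exI[of _ \<sigma>], rule exI[of _ "\<lambda>_. 1"]) (use \<sigma> in simp)
  moreover have "w y \<in> cone_k p q" if "y \<in> cone_g ?n" for y
  proof -
    have y: "antimono_on {1..?n} y" "\<And>k. k \<in> {1..?n} \<Longrightarrow> 0 \<le> y k" "\<And>k. k \<notin> {1..?n} \<Longrightarrow> y k = 0"
      using that by (auto simp: cone_g_def decreasing_nonneg_def Rn_def)
    have "w y l \<le> w y k" if "1 \<le> k" "k \<le> l" "l \<le> ?n" "l \<le> p \<or> p < k" for k l
      unfolding w_def using mono[OF that] that in_iff[of k] in_iff[of l]
      by (intro monotone_onD[OF y(1)]) auto
    moreover have "0 \<le> w y k" if "k \<in> {1..?n}" for k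
      using y(2) in_iff that unfolding w_def by blast
    moreover have "w y k = 0" if "k \<notin> {1..?n}" for k
      using y(3) in_iff that unfolding w_def by blast
    ultimately show ?thesis
      by (auto simp: cone_k_def decreasing_nonneg_def Rn_def monotone_on_def)
  qed
  moreover have "v = w (v \<circ> \<tau>)" by (simp add: w_def \<tau>\<sigma>)
  ultimately show ?thesis
    using z by (intro bexI[of _ w] image_eqI[of _ _ "v \<circ> \<tau>"]) (auto simp: W1_def)
qed

text \<open>A negative sign would make an entry of the image of a nonnegative vector nonpositive.\<close>

lemma signed_perm_positive:
  assumes "w \<in> signed_perms n" "z \<in> cone_g n" "\<And>k. k \<in> {1..n} \<Longrightarrow> 0 < w z k"
  obtains \<sigma> where "\<sigma> permutes {1..n}" "w = (\<lambda>y k. y (\<sigma> k))"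
proof -
  obtain \<sigma> \<epsilon> where \<sigma>: "\<sigma> permutes {1..n}" and \<epsilon>: "\<And>k. \<epsilon> k \<in> {1, -1}" "\<And>k. k \<notin> {1..n} \<Longrightarrow> \<epsilon> k = 1"
    and w: "w = (\<lambda>z k. \<epsilon> k * z (\<sigma> k))"
    using assms(1) unfolding signed_perms_def by blast
  have "\<epsilon> k = 1" for k
  proof (cases "k \<in> {1..n}")
    case True
    then have "0 \<le> z (\<sigma> k)"
      using assms(2) permutes_in_image[OF \<sigma>, of k] by (auto simp: cone_g_def decreasing_nonneg_def)
    then show ?thesis using \<epsilon>(1)[of k] assms(3)[OF True] by (auto simp: w)
  qed (rule \<epsilon>(2))
  then show thesis using \<sigma> w by (intro that[of \<sigma>]) auto
qed

text \<open>The gap condition is a pigeonhole argument: of three consecutive entries of \<open>z\<close>, two come from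
  the same block of \<open>v\<close> and therefore differ by at least \<open>2\<close>.\<close>

lemma spread_sorted:
  assumes v: "spread p q v" and \<sigma>: "\<sigma> permutes {1..p+q}" and z: "z \<in> cone_g (p + q)"
    and vz: "v = z \<circ> \<sigma>"
  shows "sparse_decreasing (p + q) z"
proof -
  let ?n = "p + q"
  have ints: "\<And>k. k \<in> {1..?n} \<Longrightarrow> v k \<in> \<int>" and ge: "\<And>k. k \<in> {1..?n} \<Longrightarrow> 2 \<le> v k"
    and sep: "\<And>k l. \<lbrakk>1 \<le> k; k < l; l \<le> ?n; l \<le> p \<or> p < k\<rbrakk> \<Longrightarrow> v l + 2 \<le> v k"
    using v by (auto simp: spread_def)
  define \<tau> where "\<tau> = inv \<sigma>"
  have \<tau>: "\<tau> k \<in> {1..?n} \<longleftrightarrow> k \<in> {1..?n}" for k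
    unfolding \<tau>_def by (rule permutes_in_image[OF permutes_inv[OF \<sigma>]])
  have inj: "\<tau> k = \<tau> l \<longleftrightarrow> k = l" for k l
    unfolding \<tau>_def using permutes_inj[OF permutes_inv[OF \<sigma>]] by (auto simp: inj_eq)
  have zv: "z k = v (\<tau> k)" for k
    by (simp add: vz \<tau>_def permutes_inverses(1)[OF \<sigma>])
  have anti: "z l \<le> z k" if "1 \<le> k" "k \<le> l" "l \<le> ?n" for k l
    using z that by (auto simp: cone_g_def decreasing_nonneg_def intro: monotone_onD)
  \<comment> \<open>The entries differ by at least \<open>2\<close> in one direction, and monotonicity of \<open>z\<close> tells which.\<close>
  have same_block: "z l + 2 \<le> z k" if "1 \<le> k" "k < l" "l \<le> ?n" "\<tau> k \<le> p \<longleftrightarrow> \<tau> l \<le> p" for k l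
  proof -
    have "\<tau> k \<noteq> \<tau> l" using that(2) by (simp add: inj)
    then have "z l + 2 \<le> z k \<or> z k + 2 \<le> z l"
      using sep[of "\<tau> k" "\<tau> l"] sep[of "\<tau> l" "\<tau> k"] \<tau>[of k] \<tau>[of l] that
      unfolding zv by (cases "\<tau> k < \<tau> l") auto
    then show ?thesis using anti[of k l] that by auto
  qed
  show ?thesis
  proof
    show "z (k + 2) + 2 \<le> z k" if "1 \<le> k" "k + 2 \<le> ?n" for k
      using same_block[of k "k + 1"] same_block[of k "k + 2"] same_block[of "k + 1" "k + 2"]
        anti[of k "k + 1"] anti[of "k + 1" "k + 2"] that
      by (cases "\<tau> k \<le> p"; cases "\<tau> (k + 1) \<le> p"; cases "\<tau> (k + 2) \<le> p") auto
  qed (use z ints ge \<tau> in \<open>auto simp: zv simp del: atLeastAtMost_iff\<close>)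
qed

section \<open>The lambda norm\<close>

lemma chamber_sorted:
  assumes v: "spread p q v" and w: "w \<in> W1 p q" and vw: "v \<in> w ` cone_g (p + q)"
  obtains \<sigma> z where "\<sigma> permutes {1..p+q}" "w = (\<lambda>y k. y (\<sigma> k))" "v = (\<lambda>k. z (\<sigma> k))"
    "sparse_decreasing (p + q) z"
proof -
  obtain z where z: "z \<in> cone_g (p + q)" "v = w z" using vw by blast
  have "0 < w z k" if "k \<in> {1..p+q}" for k
    using v that by (force simp: spread_def z(2))
  then obtain \<sigma> where \<sigma>: "\<sigma> permutes {1..p+q}" "w = (\<lambda>y k. y (\<sigma> k))"
    using signed_perm_positive[OF _ z(1)] w by (auto simp: W1_def)
  show thesis
    using that[OF \<sigma>] spread_sorted[OF v \<sigma>(1) z(1)] z(2) \<sigma>(2) by (auto simp: o_def)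
qed

text \<open>A permutation of coordinates preserves inner products, so it carries the projection to the
  dominant chamber to the projection to the permuted chamber.\<close>

lemma (in sparse_decreasing) nearest_point_permuted:
  assumes \<sigma>: "\<sigma> permutes {1..n}"
  shows "nearest_point n ((\<lambda>y k. y (\<sigma> k)) ` cone_g n) (\<lambda>k. z (\<sigma> k) - rho n (\<sigma> k))
    = (\<lambda>k. averaged (\<sigma> k))"
proof (rule nearest_point_eqI)
  show "(\<lambda>y k. y (\<sigma> k)) ` cone_g n \<subseteq> Rn n"
    using permutes_in_image[OF \<sigma>] by (auto simp: cone_g_def Rn_def simp del: atLeastAtMost_iff)
  show "(\<lambda>k. averaged (\<sigma> k)) \<in> (\<lambda>y k. y (\<sigma> k)) ` cone_g n"
    using averaged_in_cone by (intro image_eqI[of _ _ averaged]) auto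
  fix u assume "u \<in> (\<lambda>y k. y (\<sigma> k)) ` cone_g n"
  then obtain y where y: "y \<in> cone_g n" "u = (\<lambda>k. y (\<sigma> k))" by blast
  show "(\<Sum>k=1..n. (z (\<sigma> k) - rho n (\<sigma> k) - averaged (\<sigma> k)) * (u k - averaged (\<sigma> k))) \<le> 0"
    using residual_obtuse[OF y(1)]
      sum.permute[OF \<sigma>, of "\<lambda>k. (z k - rho n k - averaged k) * (y k - averaged k)"]
    by (simp add: y(2) o_def)
qed

text \<open>Both sides are read off from the number of ordered pairs of positions with equal entries. For \<open>z\<close>
  it is \<open>n\<close> plus twice the number of ties. For \<open>v\<close> each block contributes only its diagonal, and every
  coincidence between the blocks is counted twice.\<close>

lemma tie_count_eq:
  assumes v: "spread p q v" and vs: "v = shifted p q \<mu>"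
    and \<sigma>: "\<sigma> permutes {1..p+q}" and vz: "v = (\<lambda>k. z (\<sigma> k))" and z: "sparse_decreasing (p + q) z"
  shows "real (tie_count p q \<mu>) = (\<Sum>k=1..p+q. sparse_decreasing.tie (p + q) z k)"
proof -
  interpret sparse_decreasing "p + q" z by (rule z)
  have sep: "\<And>k l. \<lbrakk>1 \<le> k; k < l; l \<le> p + q; l \<le> p \<or> p < k\<rbrakk> \<Longrightarrow> v l + 2 \<le> v k"
    using v by (auto simp: spread_def)
  let ?e = "\<lambda>k l. of_bool (v k = v l) :: real"
  have diag: "?e k l = of_bool (k = l)" if "k \<in> {1..p+q}" "l \<in> {1..p+q}" "k \<le> p \<longleftrightarrow> l \<le> p" for k l
    using sep[of k l] sep[of l k] that by (cases k l rule: linorder_cases) force+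
  have "(\<Sum>i=1..p. \<Sum>k=1..p. ?e i k) = (\<Sum>i=1..p. \<Sum>k=1..p. of_bool (i = k))"
    by (intro sum.cong diag) auto
  then have D1: "(\<Sum>i=1..p. \<Sum>k=1..p. ?e i k) = real p" by (simp add: of_bool_def)
  have "(\<Sum>j=1..q. \<Sum>k=1..q. ?e (p + j) (p + k)) = (\<Sum>j=1..q. \<Sum>k=1..q. of_bool (p + j = p + k))"
    by (intro sum.cong diag) auto
  then have D2: "(\<Sum>j=1..q. \<Sum>k=1..q. ?e (p + j) (p + k)) = real q" by (simp add: of_bool_def)
  have "{(i, j). 1 \<le> i \<and> i \<le> p \<and> 1 \<le> j \<and> j \<le> q \<and> v i = v (p + j)}
      = {ij \<in> {1..p} \<times> {1..q}. v (fst ij) = v (p + snd ij)}" by auto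
  then have "real (tie_count p q \<mu>) = (\<Sum>ij\<in>{1..p} \<times> {1..q}. ?e (fst ij) (p + snd ij))"
    by (simp add: tie_count_def vs Int_def)
  also have "\<dots> = (\<Sum>i=1..p. \<Sum>j=1..q. ?e i (p + j))"
    by (simp only: sum.cartesian_product case_prod_unfold)
  finally have C: "(\<Sum>i=1..p. \<Sum>j=1..q. ?e i (p + j)) = real (tie_count p q \<mu>)" by simp
  have "(\<Sum>k=1..p+q. \<Sum>l=1..p+q. ?e k l) = real p + real q + 2 * real (tie_count p q \<mu>)"
    by (subst sum_blocks_square) (auto simp only: D1 D2 C eq_commute)
  moreover have "(\<Sum>k=1..p+q. \<Sum>l=1..p+q. ?e k l) = (\<Sum>k=1..p+q. \<Sum>l=1..p+q. of_bool (z k = z l))"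
    unfolding vz by (rule sum_permuted_square[OF \<sigma>])
  ultimately show ?thesis using equal_pairs by simp
qed

text \<open>Only the cross term \<open>\<Sum> z k \<cdot> \<rho> k\<close> with \<open>\<rho> k = n - k + 1\<close> depends on the order of the entries, through
  \<open>\<Sum> k \<cdot> z k\<close>. By \<open>sum_min_square\<close>, applied to \<open>z\<close> and to both blocks, it differs from
  \<open>\<Sum> i \<cdot> x i + \<Sum> j \<cdot> y j\<close> exactly by the mixed sum of minima.\<close>

lemma shifted_norm_formula:
  fixes x y z :: "nat \<Rightarrow> real"
  assumes \<sigma>: "\<sigma> permutes {1..p+q}" and z: "z \<in> cone_g (p + q)"
    and vz: "(\<lambda>k. z (\<sigma> k)) = blocks p q x y"
    and x: "antimono_on {1..p} x" and y: "antimono_on {1..q} y"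
  shows "(\<Sum>k=1..p+q. (z k - rho (p + q) k)\<^sup>2)
    = (\<Sum>i=1..p. (x i)\<^sup>2 - 2 * (real (p + q) - real i + 1) * x i)
      + (\<Sum>j=1..q. (y j)\<^sup>2 - 2 * (real (p + q) - real j + 1) * y j)
      + (\<Sum>s=1..p+q. (real s)\<^sup>2)
      + 2 * (\<Sum>i=1..p. \<Sum>j=1..q. min (x i) (y j))"
proof -
  let ?n = "p + q"
  let ?v = "blocks p q x y"
  have bx: "?v i = x i" if "i \<in> {1..p}" for i using that by (simp add: blocks_def)
  have bv: "?v (p + j) = y j" if "j \<in> {1..q}" for j using that by (simp add: blocks_def)
  have separable: "(\<Sum>k=1..?n. g (z k)) = (\<Sum>i=1..p. g (x i)) + (\<Sum>j=1..q. g (y j))"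
    for g :: "real \<Rightarrow> real"
  proof -
    have "(\<Sum>k=1..?n. g (z k)) = (\<Sum>k=1..?n. g (?v k))"
      using sum.permute[OF \<sigma>, of "\<lambda>k. g (z k)"] by (simp add: o_def flip: vz)
    also have "\<dots> = (\<Sum>i=1..p. g (?v i)) + (\<Sum>j=1..q. g (?v (p + j)))" by (rule sum_blocks)
    finally show ?thesis by (simp add: bx bv)
  qed
  have anti: "antimono_on {1..?n} z" using z by (simp add: cone_g_def decreasing_nonneg_def)
  have "(\<Sum>k=1..?n. (2 * real k - 1) * z k) = (\<Sum>k=1..?n. \<Sum>l=1..?n. min (?v k) (?v l))"
    unfolding sum_min_square[OF anti, symmetric] vz[symmetric]
    by (rule sum_permuted_square[OF \<sigma>, symmetric])
  also have "\<dots> = (\<Sum>i=1..p. \<Sum>k=1..p. min (x i) (x k)) + (\<Sum>j=1..q. \<Sum>k=1..q. min (y j) (y k))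
      + 2 * (\<Sum>i=1..p. \<Sum>j=1..q. min (x i) (y j))"
    by (subst sum_blocks_square) (simp_all add: min.commute bx bv)
  also have "\<dots> = (\<Sum>i=1..p. (2 * real i - 1) * x i) + (\<Sum>j=1..q. (2 * real j - 1) * y j)
      + 2 * (\<Sum>i=1..p. \<Sum>j=1..q. min (x i) (y j))"
    by (simp only: sum_min_square[OF x] sum_min_square[OF y])
  finally have weighted: "(\<Sum>k=1..?n. (2 * real k - 1) * z k)
      = (\<Sum>i=1..p. (2 * real i - 1) * x i) + (\<Sum>j=1..q. (2 * real j - 1) * y j)
      + 2 * (\<Sum>i=1..p. \<Sum>j=1..q. min (x i) (y j))" .
  have rho_sq: "(\<Sum>k=1..?n. (rho ?n k)\<^sup>2) = (\<Sum>s=1..?n. (real s)\<^sup>2)"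
    by (rule sum.reindex_bij_witness[of _ "\<lambda>s. ?n + 1 - s" "\<lambda>k. ?n + 1 - k"])
      (auto simp: rho_def of_nat_diff algebra_simps)
  \<comment> \<open>Subtracting the weights \<open>2 k - 1\<close> of \<open>sum_min_square\<close> leaves a coefficient that is the
    same at all positions.\<close>
  define c where "c = 2 * real ?n + 1"
  have split: "(\<Sum>i=1..m. (f i)\<^sup>2 - 2 * (real ?n - real i + 1) * f i)
      = (\<Sum>i=1..m. (f i)\<^sup>2 - c * f i) + (\<Sum>i=1..m. (2 * real i - 1) * f i)" for m f
    unfolding sum.distrib[symmetric] by (intro sum.cong) (auto simp: c_def algebra_simps)
  have "(\<Sum>k=1..?n. (z k - rho ?n k)\<^sup>2)
      = (\<Sum>k=1..?n. (z k)\<^sup>2 - 2 * (real ?n - real k + 1) * z k) + (\<Sum>k=1..?n. (rho ?n k)\<^sup>2)"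
    unfolding sum.distrib[symmetric]
    by (intro sum.cong) (auto simp: rho_def power2_eq_square algebra_simps)
  then show ?thesis
    unfolding split rho_sq weighted separable[of "\<lambda>a. a\<^sup>2 - c * a"] by simp
qed

theorem lemma3p2:
  fixes p q n :: nat and \<mu> x y :: "nat \<Rightarrow> real"
  assumes "1 \<le> p" and "p \<le> q" and "n = p + q"
    and "dominant_weight p q \<mu>"
    and "shifted p q \<mu> = blocks p q x y"
  shows "(\<forall>w \<in> W1 p q. shifted p q \<mu> \<in> w ` cone_g n \<longrightarrow>
            (lambda_norm p q \<mu>)\<^sup>2
              = (L2_set (shifted p q \<mu> - w (rho n)) {1..n})\<^sup>2 - real (tie_count p q \<mu>) / 2) \<and>
         (lambda_norm p q \<mu>)\<^sup>2
            = (\<Sum>i=1..p. (x i)\<^sup>2 - 2 * (real n - real i + 1) * x i)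
            + (\<Sum>j=1..q. (y j)\<^sup>2 - 2 * (real n - real j + 1) * y j)
            + (\<Sum>s=1..n. (real s)\<^sup>2)
            + 2 * (\<Sum>i=1..p. \<Sum>j=1..q. min (x i) (y j))
            - real (tie_count p q \<mu>) / 2"
proof -
  define F where "F = (\<Sum>i=1..p. (x i)\<^sup>2 - 2 * (real n - real i + 1) * x i)
            + (\<Sum>j=1..q. (y j)\<^sup>2 - 2 * (real n - real j + 1) * y j)
            + (\<Sum>s=1..n. (real s)\<^sup>2)
            + 2 * (\<Sum>i=1..p. \<Sum>j=1..q. min (x i) (y j))"
  let ?v = "shifted p q \<mu>"
  have n: "n = p + q" by fact
  have v: "spread p q ?v" by (rule spread_shifted) fact
  have sep: "\<And>k l. \<lbrakk>1 \<le> k; k < l; l \<le> p + q; l \<le> p \<or> p < k\<rbrakk> \<Longrightarrow> ?v l + 2 \<le> ?v k"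
    using v by (auto simp: spread_def)
  have x: "antimono_on {1..p} x"
  proof (rule monotone_onI)
    fix i k assume "i \<in> {1..p}" "k \<in> {1..p}" "i \<le> k"
    then show "x i \<ge> x k"
      using sep[of i k] by (cases "i = k") (auto simp: assms(5) blocks_def)
  qed
  have y: "antimono_on {1..q} y"
  proof (rule monotone_onI)
    fix j k assume "j \<in> {1..q}" "k \<in> {1..q}" "j \<le> k"
    then show "y j \<ge> y k"
      using sep[of "p + j" "p + k"] by (cases "j = k") (auto simp: assms(5) blocks_def)
  qed
  \<comment> \<open>The right-hand sides do not depend on \<open>w\<close>, so it does not matter which \<open>w\<close> defines \<open>\<lambda>\<^sub>a\<close>.\<close>
  have chamber: "(L2_set (?v - w (rho n)) {1..n})\<^sup>2 = F \<and>
      (L2_set (nearest_point n (w ` cone_g n) (?v - w (rho n))) {1..n})\<^sup>2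
        = F - real (tie_count p q \<mu>) / 2"
    if w: "w \<in> W1 p q" and vw: "?v \<in> w ` cone_g n" for w
  proof -
    obtain \<sigma> z where \<sigma>: "\<sigma> permutes {1..n}" and w: "w = (\<lambda>y k. y (\<sigma> k))"
      and vz: "?v = (\<lambda>k. z (\<sigma> k))" and z: "sparse_decreasing n z"
      using chamber_sorted[OF v w] vw unfolding n by blast
    interpret sparse_decreasing n z by (rule z)
    have diff: "?v - w (rho n) = (\<lambda>k. z (\<sigma> k) - rho n (\<sigma> k))"
      unfolding w by (rule ext) (simp add: vz)
    have norm: "(L2_set (\<lambda>k. f (\<sigma> k)) {1..n})\<^sup>2 = (\<Sum>k=1..n. (f k)\<^sup>2)" for f
      using sum.permute[OF \<sigma>, of "\<lambda>k. (f k)\<^sup>2"] by (simp add: L2_set_def sum_nonneg o_def)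
    have "(\<Sum>k=1..n. (z k - rho n k)\<^sup>2) = F"
      using shifted_norm_formula[of \<sigma> p q z x y] \<sigma> decreasing x y vz assms(5)
      unfolding F_def n by simp
    moreover have "(\<Sum>k=1..n. tie k) = real (tie_count p q \<mu>)"
      unfolding n by (rule tie_count_eq[where v = ?v and \<sigma> = \<sigma> and z = z,
        OF v refl \<sigma>[unfolded n] vz z[unfolded n], symmetric])
    moreover have "nearest_point n (w ` cone_g n) (?v - w (rho n)) = (\<lambda>k. averaged (\<sigma> k))"
      unfolding diff unfolding w by (rule nearest_point_permuted[OF \<sigma>])
    ultimately show ?thesis
      using norm[of averaged] norm[of "\<lambda>k. z k - rho n k"] norm_averaged by (simp add: diff)
  qed
  have ex: "\<exists>w. w \<in> W1 p q \<and> ?v \<in> w ` cone_g n"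
    using spread_chamber[OF v] by (auto simp: n)
  define w0 where "w0 = (SOME w. w \<in> W1 p q \<and> ?v \<in> w ` cone_g n)"
  have "w0 \<in> W1 p q \<and> ?v \<in> w0 ` cone_g n"
    unfolding w0_def using ex by (rule someI_ex)
  then have L: "(lambda_norm p q \<mu>)\<^sup>2 = F - real (tie_count p q \<mu>) / 2"
    using chamber[of w0] by (simp add: lambda_norm_def lambda_a_def Let_def w0_def n)
  show ?thesis
  proof (intro conjI ballI impI)
    fix w assume "w \<in> W1 p q" "?v \<in> w ` cone_g n"
    then show "(lambda_norm p q \<mu>)\<^sup>2
        = (L2_set (?v - w (rho n)) {1..n})\<^sup>2 - real (tie_count p q \<mu>) / 2"
      using chamber L by presburger
  qed (rule L[unfolded F_def])
qed

end
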